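(* Let $\mathcal{N}_1$ and $\mathcal{N}_2$ be any quantum channels whose input systems are both $\mathbb{C}^2$. Then their one-shot zero-error classical capacity cannot be activated; that is, it is not the case that at least one of $\mathcal{C}_0^{(1)}(\mathcal{N}_1)$, $\mathcal{C}_0^{(1)}(\mathcal{N}_2)$ is $0$ and $$\mathcal{C}_0^{(1)}(\mathcal{N}_1\otimes\mathcal{N}_2)>\mathcal{C}_0^{(1)}(\mathcal{N}_1)+\mathcal{C}_0^{(1)}(\mathcal{N}_2).$$
   Context: A quantum channel with input system $\mathbb{C}^n$ is a completely positive trace-preserving map $\mathcal{N}:\mathcal{L}(\mathbb{C}^n)\to\mathcal{L}(\mathbb{C}^{n'})$, $\mathcal{N}(\rho)=\sum_iE_i\rho E_i^\dagger$ with Kraus operators $E_i$, $\sum_iE_i^\dagger E_i=I$ (finite-dimensional, arbitrary output dimension $n'$). Its noncommutative graph is $S(\mathcal{N})=\mathrm{span}\{E_i^\dagger E_j: i,j\}\subseteq\mathcal{L}(\mathbb{C}^n)$. Let $\alpha(\mathcal{N})$ be the maximum number $m$ of nonzero vectors $|\psi_1\rangle,\dots,|\psi_m\rangle\in\mathbb{C}^n$ such that $|\psi_s\rangle\langle\psi_t|\perp S(\mathcal{N})$ for all $s\neq t$, where $\perp$ is with respect to the Hilbert–Schmidt inner product $\langle X,Y\rangle=\mathrm{Tr}(X^\dagger Y)$. The one-shot zero-error classical capacity is $\mathcal{C}_0^{(1)}(\mathcal{N})=\log_2\alpha(\mathcal{N})$. It depends only on $S(\mathcal{N})$, and $S(\mathcal{N}_1\otimes\mathcal{N}_2)=S(\mathcal{N}_1)\otimes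 S(\mathcal{N}_2)$. *)

theory Defs
  imports "HOL-Analysis.Analysis"
begin

text \<open>
  Operators from \<open>\<complex>\<^sup>n\<close> to \<open>\<complex>\<^sup>m\<close> are matrices of type \<^typ>\<open>complex^'n^'m\<close>
  (rows indexed by \<^typ>\<open>'m\<close>); the tensor product of \<open>\<complex>\<^sup>a\<close> and \<open>\<complex>\<^sup>b\<close> is indexed by the
  product type \<^typ>\<open>'a \<times> 'b\<close>.
\<close>

definition cinner :: "complex^'n \<Rightarrow> complex^'n \<Rightarrow> complex" where
  "cinner x y = (\<Sum>i\<in>UNIV. cnj (x $ i) * y $ i)"

definition adj :: "complex^'n^'m \<Rightarrow> complex^'m^'n" where
  "adj A = (\<chi> i j. cnj (A $ j $ i))"

definition outer :: "complex^'m \<Rightarrow> complex^'n \<Rightarrow> complex^'n^'m" where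
  "outer x y = (\<chi> i j. x $ i * cnj (y $ j))"

definition hs_inner :: "complex^'n^'n \<Rightarrow> complex^'n^'n \<Rightarrow> complex" where
  "hs_inner X Y = trace (adj X ** Y)"

definition kron :: "complex^'a^'c \<Rightarrow> complex^'b^'d \<Rightarrow> complex^('a \<times> 'b)^('c \<times> 'd)" where
  "kron A B = (\<chi> i j. A $ fst i $ fst j * B $ snd i $ snd j)"

text \<open>
  Matrices as a complex vector space; the constants \<open>span\<close> and \<open>linear\<close> for the type class
  \<open>real_vector\<close> would only allow real coefficients.
\<close>

definition mscale :: "complex \<Rightarrow> complex^'n^'m \<Rightarrow> complex^'n^'m" where
  "mscale c A = (\<chi> i j. c * A $ i $ j)"

interpretation cmat: vector_space "mscale :: complex \<Rightarrow> complex^'n^'m \<Rightarrow> complex^'n^'m"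
  by unfold_locales (simp_all add: mscale_def vec_eq_iff algebra_simps)

definition clinear_map :: "(complex^'n^'n \<Rightarrow> complex^'m^'m) \<Rightarrow> bool" where
  "clinear_map N \<longleftrightarrow> Vector_Spaces.linear mscale mscale N"

text \<open>
  A family \<open>X i j\<close> (\<open>i, j < k\<close>) of \<open>n \<times> n\<close> matrices stands for the block matrix
  \<open>\<Sum> |i\<rangle>\<langle>j| \<otimes> X i j\<close> on \<open>\<complex>\<^sup>k \<otimes> \<complex>\<^sup>n\<close>, and a family \<open>v i\<close> for the vector \<open>\<Sum> |i\<rangle> \<otimes> v i\<close>. Under this
  identification the map \<open>id\<^sub>k \<otimes> N\<close> acts by applying \<open>N\<close> to each block, so that the dimension
  \<open>k\<close> of the ancilla can be quantified over.
\<close>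

definition block_psd :: "nat \<Rightarrow> (nat \<Rightarrow> nat \<Rightarrow> complex^'n^'n) \<Rightarrow> bool" where
  "block_psd k X \<longleftrightarrow>
     (\<forall>v. (\<Sum>i<k. \<Sum>j<k. cinner (v i) (X i j *v v j)) \<in> \<real>\<^sub>\<ge>\<^sub>0)"

definition completely_positive :: "(complex^'n^'n \<Rightarrow> complex^'m^'m) \<Rightarrow> bool" where
  "completely_positive N \<longleftrightarrow>
     clinear_map N \<and> (\<forall>k X. block_psd k X \<longrightarrow> block_psd k (\<lambda>i j. N (X i j)))"

definition trace_preserving :: "(complex^'n^'n \<Rightarrow> complex^'m^'m) \<Rightarrow> bool" where
  "trace_preserving N \<longleftrightarrow> (\<forall>\<rho>. trace (N \<rho>) = trace \<rho>)"

definition quantum_channel :: "(complex^'n^'n \<Rightarrow> complex^'m^'m) \<Rightarrow> bool" where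
  "quantum_channel N \<longleftrightarrow> completely_positive N \<and> trace_preserving N"

definition kraus_rep ::
  "(complex^'n^'n \<Rightarrow> complex^'m^'m) \<Rightarrow> nat \<Rightarrow> (nat \<Rightarrow> complex^'n^'m) \<Rightarrow> bool" where
  "kraus_rep N r E \<longleftrightarrow>
     (\<forall>\<rho>. N \<rho> = (\<Sum>i<r. E i ** \<rho> ** adj (E i))) \<and> (\<Sum>i<r. adj (E i) ** E i) = mat 1"

definition kraus_graph :: "nat \<Rightarrow> (nat \<Rightarrow> complex^'n^'m) \<Rightarrow> (complex^'n^'n) set" where
  "kraus_graph r E = cmat.span {adj (E i) ** E j |i j. i < r \<and> j < r}"

text \<open>
  Every channel has a Kraus representation, and all its Kraus representations yield the same
  space, so the description below determines a unique set.
\<close>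

definition nc_graph :: "(complex^'n^'n \<Rightarrow> complex^'m^'m) \<Rightarrow> (complex^'n^'n) set" where
  "nc_graph N = (THE S. \<exists>r E. kraus_rep N r E \<and> S = kraus_graph r E)"

text \<open>
  For a channel the identity lies in the noncommutative graph, so admissible vectors are pairwise
  orthogonal and the maximum is over a finite set of numbers (containing \<open>0\<close> and \<open>1\<close>).
\<close>

definition channel_alpha :: "(complex^'n^'n \<Rightarrow> complex^'m^'m) \<Rightarrow> nat" where
  "channel_alpha N = Max {m. \<exists>\<psi> :: nat \<Rightarrow> complex^'n.
     (\<forall>s<m. \<psi> s \<noteq> 0) \<and>
     (\<forall>s<m. \<forall>t<m. s \<noteq> t \<longrightarrow> (\<forall>X\<in>nc_graph N. hs_inner (outer (\<psi> s) (\<psi> t)) X = 0))}"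

definition zero_error_capacity1 :: "(complex^'n^'n \<Rightarrow> complex^'m^'m) \<Rightarrow> real" where
  "zero_error_capacity1 N = log 2 (real (channel_alpha N))"

definition mat_unit :: "'n \<Rightarrow> 'n \<Rightarrow> complex^'n^'n" where
  "mat_unit a b = (\<chi> i j. if i = a \<and> j = b then 1 else 0)"

text \<open>
  The linear extension of \<open>X \<otimes> Y \<mapsto> N\<^sub>1 X \<otimes> N\<^sub>2 Y\<close>, expanded in matrix units.
\<close>

definition tensor_map ::
  "(complex^'a^'a \<Rightarrow> complex^'c^'c) \<Rightarrow> (complex^'b^'b \<Rightarrow> complex^'d^'d) \<Rightarrow>
   complex^('a \<times> 'b)^('a \<times> 'b) \<Rightarrow> complex^('c \<times> 'd)^('c \<times> 'd)" where
  "tensor_map N1 N2 \<rho> = (\<Sum>p\<in>UNIV. \<Sum>q\<in>UNIV.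
     mscale (\<rho> $ p $ q)
       (kron (N1 (mat_unit (fst p) (fst q))) (N2 (mat_unit (snd p) (snd q)))))"

lemma mat_unit_expansion: "X = (\<Sum>a\<in>UNIV. \<Sum>b\<in>UNIV. mscale (X $ a $ b) (mat_unit a b))"
proof -
  have "(\<Sum>a\<in>UNIV. \<Sum>b\<in>UNIV. X $ a $ b * (if i = a \<and> j = b then 1 else 0)) = X $ i $ j" for i j
  proof -
    have "(\<Sum>a\<in>UNIV. \<Sum>b\<in>UNIV. X $ a $ b * (if i = a \<and> j = b then 1 else 0)) =
          (\<Sum>a\<in>UNIV. if i = a then \<Sum>b\<in>UNIV. if j = b then X $ a $ b else 0 else 0)"
      by (intro sum.cong refl) (simp add: if_distrib cong: if_cong)
    also have "\<dots> = X $ i $ j" by simp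
    finally show ?thesis .
  qed
  then show ?thesis by (simp add: vec_eq_iff mscale_def mat_unit_def)
qed

lemma clinear_map_expansion:
  assumes "clinear_map N"
  shows "N X = (\<Sum>a\<in>UNIV. \<Sum>b\<in>UNIV. mscale (X $ a $ b) (N (mat_unit a b)))"
proof -
  interpret Vector_Spaces.linear mscale mscale N
    using assms by (simp add: clinear_map_def)
  show ?thesis
    by (subst mat_unit_expansion[of X]) (simp add: sum scale)
qed

lemma tensor_map_kron:
  assumes "clinear_map N1" "clinear_map N2"
  shows "tensor_map N1 N2 (kron X Y) = kron (N1 X) (N2 Y)"
proof -
  have "tensor_map N1 N2 (kron X Y) $ i $ j = kron (N1 X) (N2 Y) $ i $ j" for i j
  proof -
    let ?f = "\<lambda>a b. X $ a $ b * N1 (mat_unit a b) $ fst i $ fst j"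
    let ?g = "\<lambda>a b. Y $ a $ b * N2 (mat_unit a b) $ snd i $ snd j"
    have "tensor_map N1 N2 (kron X Y) $ i $ j =
       (\<Sum>p\<in>UNIV. \<Sum>q\<in>UNIV. ?f (fst p) (fst q) * ?g (snd p) (snd q))"
      by (simp add: tensor_map_def kron_def mscale_def mult_ac)
    also have "\<dots> = (\<Sum>a\<in>UNIV. \<Sum>c\<in>UNIV. \<Sum>b\<in>UNIV. \<Sum>d\<in>UNIV. ?f a b * ?g c d)"
      unfolding UNIV_Times_UNIV[symmetric] sum.cartesian_product' by simp
    also have "\<dots> = (\<Sum>a\<in>UNIV. \<Sum>b\<in>UNIV. ?f a b) * (\<Sum>c\<in>UNIV. \<Sum>d\<in>UNIV. ?g c d)"
      by (simp add: sum_product)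
    also have "\<dots> = N1 X $ fst i $ fst j * N2 Y $ snd i $ snd j"
      by (subst (2) clinear_map_expansion[OF assms(1)], subst (2) clinear_map_expansion[OF assms(2)])
         (simp add: mscale_def)
    finally show ?thesis by (simp add: kron_def)
  qed
  then show ?thesis by (simp add: vec_eq_iff)
qed

end

theory Submission imports Defs begin

text \<open>
  Write vectors of \<open>\<complex>\<^sup>2 \<otimes> \<complex>\<^sup>2\<close> as \<open>2 \<times> 2\<close> matrices; then \<open>|\<psi>\<rangle>\<langle>\<phi>| \<bottom> S\<^sub>1 \<otimes> S\<^sub>2\<close> says that
  \<open>Tr (X Q Y\<^sup>T P\<^sup>\<dagger>) = 0\<close> for all \<open>X \<in> S\<^sub>1\<close>, \<open>Y \<in> S\<^sub>2\<close>, where \<open>P\<close> and \<open>Q\<close> are the matrices of \<open>\<psi>\<close> and \<open>\<phi>\<close>.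
  If \<open>\<alpha>(N\<^sub>1) = 1\<close>, the orthogonal complement of \<open>S\<^sub>1\<close> contains no rank-one matrix, so it is spanned
  by at most one matrix \<open>H\<close>, which is invertible; hence \<open>Q Y\<^sup>T P\<^sup>\<dagger>\<close> is a multiple of \<open>H\<close> for every \<open>Y \<in> S\<^sub>2\<close>.
  If \<open>P\<close> or \<open>Q\<close> is singular, the multiple is zero, and if both are invertible, \<open>S\<^sub>2\<close> is at most one-dimensional;
  either way \<open>\<alpha>(N\<^sub>2) \<noteq> 1\<close>. Since \<open>I \<in> S\<^sub>2\<close>, a code of three vectors would yield three nonzero matrices
  with all \<open>P\<^sub>t P\<^sub>s\<^sup>\<dagger>\<close> traceless multiples of \<open>H\<close>. If one of them is invertible, the other two are multiples
  of the same matrix and cannot be orthogonal; if all are singular, they have rank one and pairwise orthogonal row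
  vectors in \<open>\<complex>\<^sup>2\<close>. So \<open>\<alpha>(N\<^sub>1 \<otimes> N\<^sub>2) \<le> \<alpha>(N\<^sub>2)\<close> whenever \<open>\<alpha>(N\<^sub>1) = 1\<close>.
\<close>

subsection \<open>Existence of Kraus representations\<close>

text \<open>Two nestings of one conditional, so that the sum over either index can be collapsed
  first.\<close>

lemma mat_unit_nth:
  "mat_unit a b $ i $ j = (if i = a then if j = b then 1 else 0 else 0)"
  "mat_unit a b $ i $ j = (if j = b then if i = a then 1 else 0 else 0)"
  by (simp_all add: mat_unit_def)

lemma kraus_term_nth:
  "(E ** \<rho> ** adj E) $ c $ d = (\<Sum>a\<in>UNIV. \<Sum>b\<in>UNIV. E $ c $ a * \<rho> $ a $ b * cnj (E $ d $ b))"
  by (simp add: matrix_matrix_mult_def adj_def sum_distrib_right) (rule sum.swap)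

lemma kraus_rep_mat_unit:
  assumes "kraus_rep N r E"
  shows "N (mat_unit a b) $ c $ d = (\<Sum>i<r. E i $ c $ a * cnj (E i $ d $ b))"
proof -
  have "(E i ** mat_unit a b ** adj (E i)) $ c $ d = E i $ c $ a * cnj (E i $ d $ b)" for i
    by (simp add: kraus_term_nth mat_unit_nth(2) mult_delta_left mult_delta_right)
  with assms show ?thesis by (simp add: kraus_rep_def)
qed

section \<open>Positive semidefinite forms as sums of rank-one forms\<close>

definition sesq :: "('i::finite \<Rightarrow> 'i \<Rightarrow> complex) \<Rightarrow> ('i \<Rightarrow> complex) \<Rightarrow> ('i \<Rightarrow> complex) \<Rightarrow> complex" where
  "sesq C u v = (\<Sum>i\<in>UNIV. \<Sum>j\<in>UNIV. cnj (u i) * C i j * v j)"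

definition psd_form :: "('i::finite \<Rightarrow> 'i \<Rightarrow> complex) \<Rightarrow> bool" where
  "psd_form C \<longleftrightarrow> (\<forall>v. sesq C v v \<in> \<real>\<^sub>\<ge>\<^sub>0)"

definition basis_fun :: "'i \<Rightarrow> 'i \<Rightarrow> complex" where
  "basis_fun a k = (if k = a then 1 else 0)"

lemma sesq_add_scale_left: "sesq C (\<lambda>k. u k + z * w k) v = sesq C u v + cnj z * sesq C w v"
  by (simp add: sesq_def algebra_simps sum.distrib sum_distrib_left)

lemma sesq_add_scale_right: "sesq C u (\<lambda>k. v k + z * w k) = sesq C u v + z * sesq C u w"
  by (simp add: sesq_def algebra_simps sum.distrib sum_distrib_left)

lemma sesq_basis_left: "sesq C (basis_fun a) v = (\<Sum>j\<in>UNIV. C a j * v j)"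
proof -
  have "sesq C (basis_fun a) v = (\<Sum>i\<in>UNIV. if i = a then \<Sum>j\<in>UNIV. C i j * v j else 0)"
    unfolding sesq_def by (intro sum.cong refl) (auto simp: basis_fun_def)
  then show ?thesis by simp
qed

lemma sesq_basis_right: "sesq C u (basis_fun b) = (\<Sum>i\<in>UNIV. cnj (u i) * C i b)"
  by (simp add: sesq_def basis_fun_def if_distrib[of "\<lambda>x. y * x" for y] cong: if_cong)

lemma sesq_basis: "sesq C (basis_fun a) (basis_fun b) = C a b"
  by (simp add: sesq_basis_left basis_fun_def if_distrib[of "\<lambda>x. y * x" for y] cong: if_cong)

lemmas sesq_simps = sesq_add_scale_left sesq_add_scale_right sesq_basis

text \<open>Polarization: the values at e_i + e_j and at e_i + \<i> e_j are real.\<close>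

lemma psd_form_hermitian:
  assumes "psd_form C"
  shows "C j i = cnj (C i j)"
proof -
  have im: "Im (sesq C v v) = 0" for v
    using assms by (auto simp: psd_form_def complex_nonneg_Reals_iff)
  have d: "Im (C k k) = 0" for k
    using im[of "basis_fun k"] by (simp add: sesq_basis)
  have "Im (C i j + C j i) = 0"
    using im[of "\<lambda>k. basis_fun i k + 1 * basis_fun j k"] d[of i] d[of j]
    by (simp only: sesq_simps) simp
  moreover have "Re (C i j) - Re (C j i) = 0"
    using im[of "\<lambda>k. basis_fun i k + \<i> * basis_fun j k"] d[of i] d[of j]
    by (simp only: sesq_simps) simp
  ultimately show ?thesis by (simp add: complex_eq_iff)
qed

text \<open>Along multiples of e_a added to e_j the quadratic term vanishes, so a nonzero cross term
  would make the form negative somewhere.\<close>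

lemma psd_form_diag_zero:
  assumes "psd_form C" and "C a a = 0"
  shows "C j a = 0"
proof (rule ccontr)
  assume nz: "C j a \<noteq> 0"
  define n where "n = Re (C j a) ^ 2 + Im (C j a) ^ 2"
  have n: "n > 0" using nz unfolding n_def by (auto simp: complex_eq_iff sum_power2_gt_zero_iff)
  \<comment> \<open>Chosen so that the real part of the form at the test vector below is -1.\<close>
  define s where "s = (Re (C j j) + 1) / (2 * n)"
  have "Re (sesq C v v) \<ge> 0" for v
    using assms by (auto simp: psd_form_def complex_nonneg_Reals_iff)
  from this[of "\<lambda>k. basis_fun j k + (- of_real s * cnj (C j a)) * basis_fun a k"]
  have "Re (C j j) - 2 * s * n \<ge> 0"
    unfolding sesq_simps using assms(2) psd_form_hermitian[OF assms(1), of a j]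
    by (simp add: n_def power2_eq_square algebra_simps)
  with n show False by (simp add: s_def)
qed

text \<open>Cholesky elimination: each step splits off a rank-one form and removes one index from the support.\<close>

lemma psd_form_decomposition_aux:
  assumes "finite A" and "psd_form C" and "\<And>i j. i \<notin> A \<or> j \<notin> A \<Longrightarrow> C i j = 0"
  shows "\<exists>(r::nat) w. \<forall>i j. C i j = (\<Sum>l<r. w l i * cnj (w l j))"
  using assms
proof (induction A arbitrary: C rule: finite_induct)
  case empty
  then show ?case by (intro exI[of _ 0]) auto
next
  case (insert a A)
  have herm: "C j i = cnj (C i j)" for i j
    using psd_form_hermitian[OF insert.prems(1)] .
  show ?case
  proof (cases "C a a = 0")
    case True
    have "C j a = 0" for j
      using psd_form_diag_zero[of C a, OF insert.prems(1) True] .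
    moreover from this have "C a j = 0" for j using herm[of a j] by simp
    ultimately have "C i j = 0" if "i \<notin> A \<or> j \<notin> A" for i j
      using that insert.prems(2)[of i j] by (cases "i = a"; cases "j = a") auto
    then show ?thesis using insert.IH[OF insert.prems(1)] by blast
  next
    case False
    have "C a a \<in> \<real>\<^sub>\<ge>\<^sub>0"
      using insert.prems(1) unfolding psd_form_def by (metis sesq_basis)
    then obtain c where c: "C a a = of_real c" "c > 0"
      using False by (auto simp: nonneg_Reals_def)
    \<comment> \<open>The Schur complement with pivot \<open>C a a\<close>; its row and column
      \<open>a\<close> vanish.\<close>
    define D where "D i j = C i j - C i a * C a j / C a a" for i j
    have "psd_form D"
      unfolding psd_form_def
    proof
      fix v
      \<comment> \<open>Completing the square: \<open>D\<close> at \<open>v\<close> equals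
        \<open>C\<close> at \<open>v\<close> minus \<open>t\<close> times e_a.\<close>
      define t where "t = sesq C (basis_fun a) v / C a a"
      have "sesq D v v = sesq C v v - sesq C v (basis_fun a) * sesq C (basis_fun a) v / C a a"
        by (simp add: sesq_basis_left sesq_basis_right)
           (simp add: sesq_def D_def sum_product sum_divide_distrib sum_subtractf algebra_simps, rule sum.swap)
      also have "\<dots> = sesq C (\<lambda>k. v k + (- t) * basis_fun a k) (\<lambda>k. v k + (- t) * basis_fun a k)"
        unfolding sesq_simps using False by (simp add: t_def field_simps)
      finally show "sesq D v v \<in> \<real>\<^sub>\<ge>\<^sub>0" using insert.prems(1) by (simp add: psd_form_def)
    qed
    moreover have "D i j = 0" if "i \<notin> A \<or> j \<notin> A" for i j
      using that insert.prems(2)[of i j] insert.prems(2)[of i a] insert.prems(2)[of a j] False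
      by (cases "i = a"; cases "j = a") (auto simp: D_def)
    ultimately obtain r :: nat and w where w: "\<And>i j. D i j = (\<Sum>l<r. w l i * cnj (w l j))"
      using insert.IH[of D] by blast
    define w' where "w' = w(r := \<lambda>i. C i a / of_real (sqrt c))"
    have "C i j = (\<Sum>l<Suc r. w' l i * cnj (w' l j))" for i j
    proof -
      have "(\<Sum>l<r. w' l i * cnj (w' l j)) = D i j"
        unfolding w by (intro sum.cong) (auto simp: w'_def)
      moreover have "w' r i * cnj (w' r j) = C i a * C a j / C a a"
      proof -
        have "complex_of_real (sqrt c) * complex_of_real (sqrt c) = of_real c"
          using c(2) by (simp flip: of_real_mult)
        then show ?thesis using herm[of j a] c by (simp add: w'_def)
      qed
      ultimately show ?thesis by (simp add: D_def)
    qed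
    then show ?thesis by blast
  qed
qed

lemma psd_form_decomposition:
  assumes "psd_form C"
  obtains r :: nat and w where "\<And>i j. C i j = (\<Sum>l<r. w l i * cnj (w l j))"
  using psd_form_decomposition_aux[of UNIV C] assms by auto

section \<open>The Choi form and Kraus operators\<close>

lemma cinner_matrix_vector: "cinner u (A *v v) = (\<Sum>c\<in>UNIV. \<Sum>d\<in>UNIV. cnj (u $ c) * A $ c $ d * v $ d)"
  by (simp add: cinner_def matrix_vector_mult_def sum_distrib_left mult.assoc)

text \<open>When \<open>h\<close> enumerates the indices, this is the unnormalized maximally
  entangled state; its form is a squared modulus.\<close>

lemma block_psd_mat_unit:
  fixes h :: "nat \<Rightarrow> 'n::finite"
  shows "block_psd k (\<lambda>i j. mat_unit (h i) (h j))"
proof -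
  have "cinner u (mat_unit a b *v v) = cnj (u $ a) * v $ b" for u v :: "complex^'n" and a b
    by (simp add: cinner_matrix_vector mat_unit_nth(2) mult_delta_left mult_delta_right)
  moreover have "(\<Sum>i<k. \<Sum>j<k. cnj (v i $ h i) * v j $ h j) \<in> \<real>\<^sub>\<ge>\<^sub>0" for v :: "nat \<Rightarrow> complex^'n"
  proof -
    have "(\<Sum>i<k. \<Sum>j<k. cnj (v i $ h i) * v j $ h j) = (\<Sum>i<k. v i $ h i) * cnj (\<Sum>i<k. v i $ h i)"
      by (simp add: sum_product mult.commute, rule sum.swap)
    also have "\<dots> \<in> \<real>\<^sub>\<ge>\<^sub>0" by (simp only: complex_norm_square[symmetric]) simp
    finally show ?thesis .
  qed
  ultimately show ?thesis by (simp add: block_psd_def)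
qed

text \<open>Choi's argument: complete positivity is used for an ancilla of dimension
  \<open>CARD('n)\<close> and the blocks \<open>mat_unit (h i) (h j)\<close>.\<close>

lemma choi_psd:
  fixes N :: "complex^'n^'n \<Rightarrow> complex^'m^'m"
  assumes "completely_positive N"
  shows "psd_form (\<lambda>p q. N (mat_unit (fst p) (fst q)) $ snd p $ snd q)"
  unfolding psd_form_def
proof
  fix x :: "'n \<times> 'm \<Rightarrow> complex"
  obtain h :: "nat \<Rightarrow> 'n" where h: "bij_betw h {..<CARD('n)} UNIV"
    using ex_bij_betw_nat_finite[of "UNIV :: 'n set"] by (auto simp: atLeast0LessThan)
  define v :: "nat \<Rightarrow> complex^'m" where "v i = (\<chi> c. x (h i, c))" for i
  let ?g = "\<lambda>a b. \<Sum>c\<in>UNIV. \<Sum>d\<in>UNIV. cnj (x (a, c)) * N (mat_unit a b) $ c $ d * x (b, d)"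
  have "sesq (\<lambda>p q. N (mat_unit (fst p) (fst q)) $ snd p $ snd q) x x =
      (\<Sum>a\<in>UNIV. \<Sum>c\<in>UNIV. \<Sum>b\<in>UNIV. \<Sum>d\<in>UNIV. cnj (x (a, c)) * N (mat_unit a b) $ c $ d * x (b, d))"
    unfolding sesq_def UNIV_Times_UNIV[symmetric] sum.cartesian_product' by simp
  also have "\<dots> = (\<Sum>a\<in>UNIV. \<Sum>b\<in>UNIV. ?g a b)"
    by (rule sum.cong[OF refl], rule sum.swap)
  also have "\<dots> = (\<Sum>i<CARD('n). \<Sum>b\<in>UNIV. ?g (h i) b)"
    by (rule sum.reindex_bij_betw[OF h, symmetric])
  also have "\<dots> = (\<Sum>i<CARD('n). \<Sum>j<CARD('n). ?g (h i) (h j))"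
    by (rule sum.cong[OF refl], rule sum.reindex_bij_betw[OF h, symmetric])
  also have "\<dots> = (\<Sum>i<CARD('n). \<Sum>j<CARD('n). cinner (v i) (N (mat_unit (h i) (h j)) *v v j))"
    by (simp add: cinner_matrix_vector v_def)
  also have "\<dots> \<in> \<real>\<^sub>\<ge>\<^sub>0"
    using assms block_psd_mat_unit[of "CARD('n)" h]
    by (auto simp: completely_positive_def block_psd_def)
  finally show "sesq (\<lambda>p q. N (mat_unit (fst p) (fst q)) $ snd p $ snd q) x x \<in> \<real>\<^sub>\<ge>\<^sub>0" .
qed

lemma trace_kraus_term: "trace (E ** \<rho> ** adj E) = trace (adj E ** E ** \<rho>)"
  by (metis matrix_mul_assoc trace_mul_sym)

lemma trace_mult_mat_unit: "trace (A ** mat_unit a b) = A $ b $ a"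
  by (simp add: trace_def matrix_matrix_mult_def mat_unit_nth(1) mult_delta_right)

lemma sum_matrix_mult_left: "(\<Sum>i\<in>I. A i) ** B = (\<Sum>i\<in>I. A i ** (B::complex^'n^'m))"
  by (induction I rule: infinite_finite_induct) (auto simp: vec_eq_iff matrix_matrix_mult_def sum.distrib algebra_simps)

lemma trace_sum: "trace (\<Sum>i\<in>I. A i) = (\<Sum>i\<in>I. trace (A i :: complex^'n^'n))"
  by (induction I rule: infinite_finite_induct) (auto simp: trace_def sum.distrib)

text \<open>Each rank-one summand of the Choi form, reshaped into a matrix, is a Kraus operator.
  Trace preservation, tested on matrix units, gives completeness.\<close>

lemma kraus_rep_exists:
  fixes N :: "complex^'n^'n \<Rightarrow> complex^'m^'m"
  assumes "quantum_channel N"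
  obtains r E where "kraus_rep N r E"
proof -
  have cp: "completely_positive N" and lin: "clinear_map N" and tp: "\<And>\<rho>. trace (N \<rho>) = trace \<rho>"
    using assms by (auto simp: quantum_channel_def completely_positive_def trace_preserving_def)
  obtain r :: nat and w where
    "\<And>p q. N (mat_unit (fst p) (fst q)) $ snd p $ snd q = (\<Sum>l<r. w l p * cnj (w l q))"
    using psd_form_decomposition[OF choi_psd[OF cp]] by metis
  then have w: "N (mat_unit a b) $ c $ d = (\<Sum>l<r. w l (a, c) * cnj (w l (b, d)))" for a b c d
    by (metis fst_conv snd_conv)
  define E :: "nat \<Rightarrow> complex^'n^'m" where "E l = (\<chi> c a. w l (a, c))" for l
  have N: "N \<rho> = (\<Sum>l<r. E l ** \<rho> ** adj (E l))" for \<rho>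
  proof -
    have "N \<rho> $ c $ d = (\<Sum>l<r. E l ** \<rho> ** adj (E l)) $ c $ d" for c d
    proof -
      have "N \<rho> $ c $ d = (\<Sum>a\<in>UNIV. \<Sum>b\<in>UNIV. \<Sum>l<r. E l $ c $ a * \<rho> $ a $ b * cnj (E l $ d $ b))"
        by (subst clinear_map_expansion[OF lin])
           (simp add: mscale_def w E_def sum_distrib_left mult_ac)
      also have "\<dots> = (\<Sum>a\<in>UNIV. \<Sum>l<r. \<Sum>b\<in>UNIV. E l $ c $ a * \<rho> $ a $ b * cnj (E l $ d $ b))"
        by (rule sum.cong[OF refl], rule sum.swap)
      also have "\<dots> = (\<Sum>l<r. \<Sum>a\<in>UNIV. \<Sum>b\<in>UNIV. E l $ c $ a * \<rho> $ a $ b * cnj (E l $ d $ b))"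
        by (rule sum.swap)
      finally show ?thesis by (simp add: kraus_term_nth)
    qed
    then show ?thesis by (simp add: vec_eq_iff)
  qed
  have "(\<Sum>l<r. adj (E l) ** E l) = mat 1"
  proof -
    have "(\<Sum>l<r. adj (E l) ** E l) $ b $ a = mat 1 $ b $ a" for a b
    proof -
      have "trace ((\<Sum>l<r. adj (E l) ** E l) ** mat_unit a b) = trace (N (mat_unit a b))"
        by (simp add: N sum_matrix_mult_left trace_sum trace_kraus_term)
      also have "\<dots> = trace (mat 1 ** mat_unit a b)" by (simp add: tp)
      finally show ?thesis unfolding trace_mult_mat_unit .
    qed
    then show ?thesis by (simp add: vec_eq_iff)
  qed
  with N have "kraus_rep N r E" by (simp add: kraus_rep_def)
  then show ?thesis by (rule that)
qed

subsection \<open>The noncommutative graph and zero-error codes\<close>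

lemma cinner_commute: "cinner u v = cnj (cinner v u)"
  by (simp add: cinner_def mult.commute)

lemma cinner_adj: "cinner u (adj A ** B *v v) = cinner (A *v u) (B *v v)"
proof -
  have "cinner u (adj A *v w) = cinner (A *v u) w" for w
  proof -
    have "cinner u (adj A *v w) = (\<Sum>i\<in>UNIV. \<Sum>k\<in>UNIV. cnj (u $ i) * (cnj (A $ k $ i) * w $ k))"
      by (simp add: cinner_def matrix_vector_mult_def adj_def sum_distrib_left)
    also have "\<dots> = (\<Sum>k\<in>UNIV. \<Sum>i\<in>UNIV. cnj (u $ i) * (cnj (A $ k $ i) * w $ k))"
      by (rule sum.swap)
    also have "\<dots> = cinner (A *v u) w"
      by (simp add: cinner_def matrix_vector_mult_def sum_distrib_right sum_distrib_left mult_ac)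
    finally show ?thesis .
  qed
  then show ?thesis by (simp flip: matrix_vector_mul_assoc)
qed

lemma trace_mult_outer: "trace (X ** outer v u) = cinner u (X *v v)"
  by (simp add: trace_def matrix_matrix_mult_def outer_def cinner_def matrix_vector_mult_def
      sum_distrib_left mult_ac)

lemma hs_inner_outer: "hs_inner (outer u v) X = cinner u (X *v v)"
proof -
  have "adj (outer u v) = outer v u" by (simp add: adj_def outer_def vec_eq_iff mult.commute)
  then have "hs_inner (outer u v) X = trace (X ** outer v u)"
    by (simp add: hs_inner_def trace_mul_sym[of X])
  then show ?thesis by (simp add: trace_mult_outer)
qed

lemma cinner_mscale: "cinner u (mscale c A *v v) = c * cinner u (A *v v)"
  by (simp add: cinner_matrix_vector mscale_def sum_distrib_left mult_ac)

lemma cinner_add_matrix: "cinner u ((A + B) *v v) = cinner u (A *v v) + cinner u (B *v v)"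
  by (simp add: cinner_matrix_vector sum.distrib distrib_left distrib_right)

text \<open>The condition in \<open>channel_alpha\<close>, stated on the generators of the graph:
  distinct codewords have orthogonal outputs.\<close>

definition zero_error_code :: "nat \<Rightarrow> (nat \<Rightarrow> complex^'n^'m) \<Rightarrow> nat \<Rightarrow> (nat \<Rightarrow> complex^'n) \<Rightarrow> bool" where
  "zero_error_code r E m \<psi> \<longleftrightarrow> (\<forall>s<m. \<psi> s \<noteq> 0) \<and>
     (\<forall>s<m. \<forall>t<m. s \<noteq> t \<longrightarrow> (\<forall>i<r. \<forall>j<r. cinner (E i *v \<psi> s) (E j *v \<psi> t) = 0))"

lemma kraus_graph_orthogonal_iff:
  "(\<forall>X\<in>kraus_graph r E. hs_inner (outer u v) X = 0) \<longleftrightarrow>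
   (\<forall>i<r. \<forall>j<r. cinner (E i *v u) (E j *v v) = 0)"
proof
  assume "\<forall>X\<in>kraus_graph r E. hs_inner (outer u v) X = 0"
  then show "\<forall>i<r. \<forall>j<r. cinner (E i *v u) (E j *v v) = 0"
    unfolding kraus_graph_def hs_inner_outer cinner_adj[symmetric]
    by (blast intro: cmat.span_base)
next
  assume *: "\<forall>i<r. \<forall>j<r. cinner (E i *v u) (E j *v v) = 0"
  show "\<forall>X\<in>kraus_graph r E. hs_inner (outer u v) X = 0"
  proof
    fix X assume "X \<in> kraus_graph r E"
    then show "hs_inner (outer u v) X = 0"
      unfolding kraus_graph_def hs_inner_outer
    proof (induction rule: cmat.span_induct_alt)
      case base
      then show ?case by (simp add: cinner_def)
    next
      case (step c x y)
      then show ?case using * by (auto simp: cinner_add_matrix cinner_mscale cinner_adj)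
    qed
  qed
qed

section \<open>Independence of the graph from the Kraus representation\<close>

definition frobenius :: "complex^'n^'m \<Rightarrow> complex^'n^'m \<Rightarrow> complex" where
  "frobenius X Y = (\<Sum>c\<in>UNIV. \<Sum>a\<in>UNIV. cnj (X $ c $ a) * Y $ c $ a)"

text \<open>Connects the complex pairing with the real inner product, in which orthogonal
  decomposition takes place.\<close>

lemma inner_matrix_eq_Re_frobenius: "inner X Y = Re (frobenius X Y)"
  by (simp add: frobenius_def inner_vec_def inner_complex_def)

text \<open>The right-hand side mentions only \<open>N\<close>, so the sum of squared moduli agrees
  for all Kraus representations.\<close>

lemma kraus_frobenius_sum:
  assumes "kraus_rep N r E"
  shows "(\<Sum>i<r. frobenius X (E i) * cnj (frobenius X (E i))) =
    (\<Sum>c\<in>UNIV. \<Sum>a\<in>UNIV. \<Sum>d\<in>UNIV. \<Sum>b\<in>UNIV. cnj (X $ c $ a) * X $ d $ b * N (mat_unit a b) $ c $ d)"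
proof -
  have "(\<Sum>i<r. frobenius X (E i) * cnj (frobenius X (E i))) =
    (\<Sum>i<r. \<Sum>c\<in>UNIV. \<Sum>a\<in>UNIV. \<Sum>d\<in>UNIV. \<Sum>b\<in>UNIV. cnj (X $ c $ a) * X $ d $ b * (E i $ c $ a * cnj (E i $ d $ b)))"
    by (simp add: frobenius_def sum_distrib_right) (simp add: sum_distrib_left mult_ac)
  also have "\<dots> = (\<Sum>c\<in>UNIV. \<Sum>a\<in>UNIV. \<Sum>d\<in>UNIV. \<Sum>b\<in>UNIV. \<Sum>i<r. cnj (X $ c $ a) * X $ d $ b * (E i $ c $ a * cnj (E i $ d $ b)))"
    by (simp only: sum.swap[where A = "{..<r}"])
  finally show ?thesis
    by (simp add: kraus_rep_mat_unit[OF assms] sum_distrib_left)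
qed

lemma subspace_cmat_span:
  fixes S :: "(complex^'n^'m) set"
  shows "subspace (cmat.span S)"
proof -
  have "c *\<^sub>R x = mscale (of_real c) x" for c and x :: "complex^'n^'m"
    by (simp add: mscale_def vec_eq_iff, simp add: scaleR_conv_of_real)
  then show ?thesis
    by (simp add: subspace_def cmat.span_zero cmat.span_add cmat.span_scale)
qed

text \<open>A matrix orthogonal to every Kraus operator of one representation annihilates the Choi form of
  the channel, hence is orthogonal to the Kraus operators of any other representation.\<close>

lemma kraus_operator_in_span:
  assumes E: "kraus_rep N r E" and F: "kraus_rep N r' F" and j: "j < r'"
  shows "F j \<in> cmat.span (E ` {..<r})"
proof -
  define S where "S = cmat.span (E ` {..<r})"
  have spanS: "span S = S"
    unfolding S_def by (rule span_eq_iff[THEN iffD2, OF subspace_cmat_span])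
  obtain y z where y: "y \<in> S" and z: "\<And>w. w \<in> S \<Longrightarrow> orthogonal z w" and yz: "F j = y + z"
    using orthogonal_subspace_decomp_exists[of S "F j"] unfolding spanS by blast
  \<comment> \<open>Real orthogonality to \<open>E i\<close> and to \<open>mscale \<i> (E i)\<close>
    kills the real and the imaginary part.\<close>
  have "frobenius z (E i) = 0" if "i < r" for i
  proof -
    have "E i \<in> S" unfolding S_def using that by (auto intro: cmat.span_base)
    moreover from this have "mscale \<i> (E i) \<in> S" unfolding S_def by (rule cmat.span_scale)
    moreover have "frobenius z (mscale \<i> (E i)) = \<i> * frobenius z (E i)"
      by (simp add: frobenius_def mscale_def sum_distrib_left mult_ac)
    ultimately show ?thesis
      using z[of "E i"] z[of "mscale \<i> (E i)"]
      by (simp add: orthogonal_def inner_matrix_eq_Re_frobenius complex_eq_iff)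
  qed
  then have "(\<Sum>i<r'. frobenius z (F i) * cnj (frobenius z (F i))) = 0"
    unfolding kraus_frobenius_sum[OF F] kraus_frobenius_sum[OF E, symmetric] by simp
  then have "complex_of_real (\<Sum>i<r'. (cmod (frobenius z (F i)))\<^sup>2) = 0"
    by (simp only: complex_norm_square of_real_sum)
  then have "(\<Sum>i<r'. (cmod (frobenius z (F i)))\<^sup>2) = 0"
    by (simp only: of_real_eq_0_iff)
  then have "frobenius z (F j) = 0"
    using j by (subst (asm) sum_nonneg_eq_0_iff) auto
  then have "inner z (F j) = 0" by (simp add: inner_matrix_eq_Re_frobenius)
  moreover have "inner z y = 0" using z[OF y] by (simp add: orthogonal_def)
  \<comment> \<open>\<open>z\<close> is orthogonal to \<open>y\<close> and to \<open>y + z\<close>,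
    hence to itself.\<close>
  ultimately have "z = 0" by (simp add: yz inner_add_right)
  with y yz show ?thesis by (simp add: S_def)
qed

text \<open>The product is conjugate-linear in \<open>A\<close> and linear in \<open>B\<close>,
  hence two nested span inductions.\<close>

lemma adj_mult_in_kraus_graph:
  assumes "A \<in> cmat.span (E ` {..<r})" and "B \<in> cmat.span (E ` {..<r})"
  shows "adj A ** B \<in> kraus_graph r E"
  using assms(1)
proof (induction rule: cmat.span_induct_alt)
  case base
  have "adj (0 :: complex^'a^'b) ** B = 0"
    by (simp add: adj_def matrix_matrix_mult_def vec_eq_iff)
  then show ?case by (simp add: kraus_graph_def cmat.span_zero)
next
  case (step c x y)
  from step(1) obtain i where i: "i < r" "x = E i" by auto
  have "adj x ** B \<in> kraus_graph r E" using assms(2)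
  proof (induction rule: cmat.span_induct_alt)
    case base
    then show ?case by (simp add: kraus_graph_def cmat.span_zero)
  next
    case (step c' x' y')
    have "adj x ** (mscale c' x' + y') = mscale c' (adj x ** x') + adj x ** y'"
      by (simp add: matrix_matrix_mult_def mscale_def vec_eq_iff algebra_simps sum.distrib sum_distrib_left)
    moreover have "adj x ** x' \<in> kraus_graph r E"
      unfolding kraus_graph_def using i step(1) by (auto intro!: cmat.span_base)
    ultimately show ?case
      using step by (simp add: kraus_graph_def cmat.span_add cmat.span_scale)
  qed
  moreover have "adj (mscale c x + y) ** B = mscale (cnj c) (adj x ** B) + adj y ** B"
    by (simp add: adj_def matrix_matrix_mult_def mscale_def vec_eq_iff algebra_simps sum.distrib sum_distrib_left)
  ultimately show ?case
    using step by (simp add: kraus_graph_def cmat.span_add cmat.span_scale)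
qed

lemma kraus_graph_subset:
  assumes "kraus_rep N r E" and "kraus_rep N r' F"
  shows "kraus_graph r' F \<subseteq> kraus_graph r E"
proof -
  have "{adj (F i) ** F j |i j. i < r' \<and> j < r'} \<subseteq> kraus_graph r E"
    by (auto intro!: adj_mult_in_kraus_graph kraus_operator_in_span[OF assms])
  moreover have "cmat.subspace (kraus_graph r E)"
    unfolding kraus_graph_def by (rule cmat.subspace_span)
  ultimately show ?thesis
    unfolding kraus_graph_def[of r'] by (rule cmat.span_minimal)
qed

text \<open>Graphs of any two representations include each other, so the description in
  \<open>nc_graph\<close> is met by one set only.\<close>

lemma nc_graph_eq:
  assumes "kraus_rep N r E"
  shows "nc_graph N = kraus_graph r E"
  unfolding nc_graph_def
proof (rule the_equality)
  show "\<exists>r' F. kraus_rep N r' F \<and> kraus_graph r E = kraus_graph r' F" using assms by blast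
next
  fix S assume "\<exists>r' F. kraus_rep N r' F \<and> S = kraus_graph r' F"
  then obtain r' F where F: "kraus_rep N r' F" "S = kraus_graph r' F" by blast
  show "S = kraus_graph r E"
    unfolding F(2) by (rule equalityI[OF kraus_graph_subset[OF assms F(1)] kraus_graph_subset[OF F(1) assms]])
qed

lemma channel_alpha_eq:
  assumes "kraus_rep N r E"
  shows "channel_alpha N = Max {m. \<exists>\<psi>. zero_error_code r E m \<psi>}"
  by (simp add: channel_alpha_def nc_graph_eq[OF assms] kraus_graph_orthogonal_iff zero_error_code_def)

lemma zero_error_code_mono:
  "zero_error_code r E m \<psi> \<Longrightarrow> k \<le> m \<Longrightarrow> zero_error_code r E k \<psi>"
  by (auto simp: zero_error_code_def)

text \<open>Initial segments of codes are codes, so one missing size bounds all sizes; this makes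
  the set under \<open>Max\<close> finite.\<close>

lemma channel_alpha_bounds:
  assumes "kraus_rep N r E" and "\<nexists>\<psi>. zero_error_code r E (Suc k) \<psi>"
  shows "channel_alpha N \<le> k" and "zero_error_code r E m \<psi> \<Longrightarrow> m \<le> channel_alpha N"
proof -
  let ?M = "{m. \<exists>\<psi>. zero_error_code r E m \<psi>}"
  have sub: "?M \<subseteq> {..k}"
    using assms(2) zero_error_code_mono[of r E _ _ "Suc k"] not_less_eq_eq by blast
  then have fin: "finite ?M" by (rule finite_subset) simp
  have "0 \<in> ?M" by (simp add: zero_error_code_def)
  then show "channel_alpha N \<le> k"
    unfolding channel_alpha_eq[OF assms(1)] using sub fin by (subst Max_le_iff) auto
  show "m \<le> channel_alpha N" if "zero_error_code r E m \<psi>"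
    unfolding channel_alpha_eq[OF assms(1)] using fin that by (intro Max_ge) auto
qed

lemma channel_alpha_ge_1:
  assumes "kraus_rep N r E" and "\<nexists>\<psi>. zero_error_code r E (Suc k) \<psi>"
  shows "1 \<le> channel_alpha N"
proof (rule channel_alpha_bounds(2)[OF assms])
  \<comment> \<open>Any single nonzero vector is a code; \<open>undefined\<close> is an arbitrary
    index.\<close>
  show "zero_error_code r E 1 (\<lambda>_. axis undefined 1)"
    by (simp add: zero_error_code_def axis_eq_0_iff)
qed

subsection \<open>Kraus operators of tensor products\<close>

text \<open>Kraus families are indexed by numbers, so a pair of Kraus indices is coded as
  \<open>i * r2 + j\<close>.\<close>

lemma sum_lessThan_mult:
  "(\<Sum>k<r1 * r2. f (k div r2) (k mod r2)) = (\<Sum>i<r1. \<Sum>j<r2. f i (j::nat))"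
proof -
  have "(\<Sum>k<r1 * r2. f (k div r2) (k mod r2)) =
      (\<Sum>i<r1. \<Sum>k\<in>{i * r2..<i * r2 + r2}. f (k div r2) (k mod r2))"
    by (rule sum.nat_group[symmetric])
  also have "\<dots> = (\<Sum>i<r1. \<Sum>j<r2. f i j)"
  proof (rule sum.cong[OF refl])
    fix i
    show "(\<Sum>k\<in>{i * r2..<i * r2 + r2}. f (k div r2) (k mod r2)) = (\<Sum>j<r2. f i j)"
      by (subst sum.atLeastLessThan_shift_0) (auto simp: atLeast0LessThan intro!: sum.cong)
  qed
  finally show ?thesis .
qed

lemma kron_mult: "kron A B ** kron C D = kron (A ** C) (B ** D)"
proof -
  have "(kron A B ** kron C D) $ i $ j = kron (A ** C) (B ** D) $ i $ j" for i j
    unfolding matrix_matrix_mult_def kron_def UNIV_Times_UNIV[symmetric] sum.cartesian_product'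
    by (simp add: sum_product mult_ac)
  then show ?thesis by (simp add: vec_eq_iff)
qed

lemma adj_kron: "adj (kron A B) = kron (adj A) (adj B)"
  by (simp add: adj_def kron_def vec_eq_iff)

lemma kron_sum: "kron (\<Sum>i\<in>I. A i) (\<Sum>j\<in>J. B j) = (\<Sum>i\<in>I. \<Sum>j\<in>J. kron (A i) (B j))"
  by (simp add: kron_def vec_eq_iff sum_product)

lemma kron_mat_1: "kron (mat 1) (mat 1) = mat 1"
  by (auto simp: kron_def mat_def vec_eq_iff prod_eq_iff)

lemma kraus_rep_tensor_map:
  assumes E: "kraus_rep N1 r1 E" and F: "kraus_rep N2 r2 F"
  shows "kraus_rep (tensor_map N1 N2) (r1 * r2) (\<lambda>k. kron (E (k div r2)) (F (k mod r2)))"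
proof -
  let ?K = "\<lambda>i j. kron (E i) (F j)"
  have "tensor_map N1 N2 \<rho> = (\<Sum>i<r1. \<Sum>j<r2. ?K i j ** \<rho> ** adj (?K i j))" for \<rho>
  proof -
    have "tensor_map N1 N2 \<rho> $ c $ d = (\<Sum>i<r1. \<Sum>j<r2. ?K i j ** \<rho> ** adj (?K i j)) $ c $ d" for c d
    proof -
      have "tensor_map N1 N2 \<rho> $ c $ d = (\<Sum>p\<in>UNIV. \<Sum>q\<in>UNIV. \<Sum>i<r1. \<Sum>j<r2.
          ?K i j $ c $ p * \<rho> $ p $ q * cnj (?K i j $ d $ q))"
        by (simp add: tensor_map_def mscale_def kron_def kraus_rep_mat_unit[OF E] kraus_rep_mat_unit[OF F]
            sum_distrib_right) (simp add: sum_distrib_left mult_ac)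
      also have "\<dots> = (\<Sum>i<r1. \<Sum>p\<in>UNIV. \<Sum>q\<in>UNIV. \<Sum>j<r2.
          ?K i j $ c $ p * \<rho> $ p $ q * cnj (?K i j $ d $ q))"
        by (simp only: sum.swap[where B = "{..<r1}"])
      also have "\<dots> = (\<Sum>i<r1. \<Sum>j<r2. \<Sum>p\<in>UNIV. \<Sum>q\<in>UNIV.
          ?K i j $ c $ p * \<rho> $ p $ q * cnj (?K i j $ d $ q))"
        by (simp only: sum.swap[where B = "{..<r2}" and A = UNIV])
      finally show ?thesis by (simp add: kraus_term_nth)
    qed
    then show ?thesis by (simp add: vec_eq_iff)
  qed
  moreover have "(\<Sum>i<r1. \<Sum>j<r2. adj (?K i j) ** ?K i j) = mat 1"
    using E F by (simp add: adj_kron kron_mult kron_mat_1 kraus_rep_def flip: kron_sum)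
  ultimately show ?thesis
    unfolding kraus_rep_def
    using sum_lessThan_mult[of "\<lambda>i j. ?K i j ** \<rho> ** adj (?K i j)" r2 r1 for \<rho>]
      sum_lessThan_mult[of "\<lambda>i j. adj (?K i j) ** ?K i j" r2 r1] by simp
qed

subsection \<open>Two-by-two matrices\<close>

text \<open>No rank-one matrix is Hilbert-Schmidt orthogonal to \<open>T\<close>; for a graph this
  means \<alpha> = 1.\<close>

definition separating :: "(complex^'n^'n) set \<Rightarrow> bool" where
  "separating T \<longleftrightarrow> (\<forall>u v. u \<noteq> 0 \<longrightarrow> v \<noteq> 0 \<longrightarrow> (\<exists>X\<in>T. cinner u (X *v v) \<noteq> 0))"

lemma det_mscale_2: "det (mscale c (A :: complex^2^2)) = c\<^sup>2 * det A"
  by (simp add: det_2 mscale_def power2_eq_square algebra_simps)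

lemma det_adj_2: "det (adj (A :: complex^2^2)) = cnj (det A)"
  by (simp add: det_2 adj_def)

lemma rank_one_of_det_0:
  assumes "det (M :: complex^2^2) = 0"
  obtains u v where "M = outer v u"
proof (cases "M = 0")
  case True
  then have "M = outer 0 0" by (simp add: outer_def vec_eq_iff)
  then show ?thesis by (rule that)
next
  case False
  then obtain i j where ij: "M $ i $ j \<noteq> 0" by (auto simp: vec_eq_iff)
  have *: "M $ k $ l * M $ i $ j = M $ k $ j * M $ i $ l" for k l
  proof -
    have "M $ 1 $ 1 * M $ 2 $ 2 = M $ 1 $ 2 * M $ 2 $ 1" using assms by (simp add: det_2)
    then show ?thesis
      using exhaust_2[of i] exhaust_2[of j] exhaust_2[of k] exhaust_2[of l]
      by (elim disjE) (simp_all add: mult.commute)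
  qed
  \<comment> \<open>Pivot column times pivot row over the pivot; the conjugate offsets the one in
    \<open>outer\<close>.\<close>
  have "M = outer (\<chi> k. M $ k $ j) (\<chi> l. cnj (M $ i $ l / M $ i $ j))"
    using ij * by (simp add: outer_def vec_eq_iff eq_divide_eq)
  then show ?thesis by (rule that)
qed

text \<open>The determinant is a quadratic polynomial in \<open>t\<close> with leading coefficient
  \<open>det A\<close>, so it has a complex root.\<close>

lemma pencil_singular:
  assumes "det (A :: complex^2^2) \<noteq> 0"
  obtains t where "det (M - mscale t A) = 0"
proof -
  define b where "b = A$1$1 * M$2$2 + M$1$1 * A$2$2 - A$1$2 * M$2$1 - M$1$2 * A$2$1"
  define s where "s = csqrt (b\<^sup>2 - 4 * det A * det M)"
  define t where "t = (b + s) / (2 * det A)"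
  have s: "s\<^sup>2 = b\<^sup>2 - 4 * det A * det M" by (simp add: s_def)
  have "det (M - mscale t A) = det A * t\<^sup>2 - b * t + det M"
    by (simp add: b_def det_2 mscale_def power2_eq_square algebra_simps)
  also have "\<dots> = (s\<^sup>2 - (b\<^sup>2 - 4 * det A * det M)) / (4 * det A)"
    using assms by (simp add: t_def field_simps power2_eq_square)
  also have "\<dots> = 0" using s by simp
  finally show ?thesis by (rule that)
qed

text \<open>A two-dimensional space of \<open>2 \<times> 2\<close> matrices contains a singular nonzero, hence rank-one, matrix.\<close>

lemma separating_annihilator:
  fixes T :: "(complex^2^2) set"
  assumes "separating T"
  obtains H where "det H \<noteq> 0" and "\<And>M. \<forall>X\<in>T. trace (X ** M) = 0 \<Longrightarrow> \<exists>c. M = mscale c H"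
proof -
  \<comment> \<open>A singular element of the annihilator has rank at most one, and
    \<open>separating\<close> excludes rank one.\<close>
  have singular: "M = 0" if M: "\<forall>X\<in>T. trace (X ** M) = 0" and "det M = 0" for M
  proof -
    obtain u v where uv: "M = outer v u" using rank_one_of_det_0[OF \<open>det M = 0\<close>] .
    have "u = 0 \<or> v = 0"
      using assms M unfolding uv trace_mult_outer separating_def by blast
    then show ?thesis by (auto simp: uv outer_def vec_eq_iff)
  qed
  show ?thesis
  proof (cases "\<exists>M. M \<noteq> 0 \<and> (\<forall>X\<in>T. trace (X ** M) = 0)")
    case True
    then obtain H where H: "H \<noteq> 0" "\<forall>X\<in>T. trace (X ** H) = 0" by blast
    then have detH: "det H \<noteq> 0" using singular by blast
    have "\<exists>c. M = mscale c H" if M: "\<forall>X\<in>T. trace (X ** M) = 0" for M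
    proof -
      obtain t where t: "det (M - mscale t H) = 0" using pencil_singular[OF detH] .
      have "trace (X ** (M - mscale t H)) = trace (X ** M) - t * trace (X ** H)" for X
        by (simp add: trace_def matrix_matrix_mult_def mscale_def sum_2 algebra_simps)
      then have "M - mscale t H = 0" using singular[OF _ t] M H(2) by simp
      then show ?thesis by auto
    qed
    with detH show ?thesis by (rule that)
  next
    case False
    \<comment> \<open>The annihilator is zero, so any invertible matrix serves as
      \<open>H\<close>.\<close>
    have "M = mscale 0 (mat 1)" if "\<forall>X\<in>T. trace (X ** M) = 0" for M
    proof -
      have "M = 0" using False that by blast
      then show ?thesis by (simp add: mscale_def vec_eq_iff)
    qed
    then show ?thesis by (intro that[of "mat 1"]) (auto simp del: cmat.scale_zero_left)
  qed
qed

lemma orthogonal_vector_2: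
  fixes w :: "complex^2"
  obtains u where "u \<noteq> 0" and "cinner u w = 0"
proof (cases "w = 0")
  case True
  have "axis 1 1 \<noteq> (0 :: complex^2)" by (simp add: axis_eq_0_iff)
  then show ?thesis using True by (intro that[of "axis 1 1"]) (simp_all add: cinner_def)
next
  case False
  define u :: "complex^2" where "u = (\<chi> i. if i = 1 then cnj (w $ 2) else - cnj (w $ 1))"
  have "u \<noteq> 0" using False by (auto simp: u_def vec_eq_iff forall_2)
  moreover have "cinner u w = 0" by (simp add: cinner_def sum_2 u_def)
  ultimately show ?thesis by (rule that)
qed

text \<open>In the plane, \<open>b\<close> and \<open>c\<close> are both orthogonal to
  \<open>a\<close>, hence parallel; being also orthogonal to \<open>b\<close>, \<open>c\<close>
  vanishes.\<close>

lemma pairwise_orthogonal_2: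
  fixes a b c :: "complex^2"
  assumes "cinner a b = 0" "cinner a c = 0" "cinner b c = 0" and "a \<noteq> 0" "b \<noteq> 0"
  shows "c = 0"
proof -
  have ab: "cnj (a$1) * b$1 + cnj (a$2) * b$2 = 0" and ac: "cnj (a$1) * c$1 + cnj (a$2) * c$2 = 0"
    and bc: "cnj (b$1) * c$1 + cnj (b$2) * c$2 = 0"
    using assms by (simp_all add: cinner_def sum_2)
  have "cnj (a$1) * (b$1 * c$2 - b$2 * c$1) = 0" "cnj (a$2) * (b$1 * c$2 - b$2 * c$1) = 0"
    using ab ac by algebra+
  moreover have "a$1 \<noteq> 0 \<or> a$2 \<noteq> 0" using \<open>a \<noteq> 0\<close> by (auto simp: vec_eq_iff forall_2)
  ultimately have par: "b$1 * c$2 - b$2 * c$1 = 0" by auto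
  define n where "n = b$1 * cnj (b$1) + b$2 * cnj (b$2)"
  have n: "n = of_real ((cmod (b$1))\<^sup>2 + (cmod (b$2))\<^sup>2)"
    unfolding n_def by (simp only: of_real_add complex_norm_square)
  have "b$1 \<noteq> 0 \<or> b$2 \<noteq> 0" using \<open>b \<noteq> 0\<close> by (auto simp: vec_eq_iff forall_2)
  then have "(cmod (b$1))\<^sup>2 + (cmod (b$2))\<^sup>2 \<noteq> 0" by (auto simp: sum_power2_eq_zero_iff)
  then have "n \<noteq> 0" unfolding n by (simp only: of_real_eq_0_iff not_False_eq_True)
  moreover have "n * c$1 = 0" "n * c$2 = 0"
    using par bc unfolding n_def by algebra+
  ultimately show ?thesis by (simp add: vec_eq_iff forall_2)
qed

lemma mscale_mult_left: "mscale c A ** B = mscale c (A ** B)"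
  by (simp add: mscale_def matrix_matrix_mult_def vec_eq_iff sum_distrib_left mult_ac)

lemma mscale_mult_right: "A ** mscale c B = mscale c (A ** B)"
  by (simp add: mscale_def matrix_matrix_mult_def vec_eq_iff sum_distrib_left mult_ac)

lemma adj_mscale: "adj (mscale c A) = mscale (cnj c) (adj A)"
  by (simp add: mscale_def adj_def vec_eq_iff)

lemma trace_mscale: "trace (mscale c A) = c * trace A"
  by (simp add: mscale_def trace_def sum_distrib_left)

lemma adj_mult: "adj (A ** B) = adj B ** adj A"
  by (simp add: adj_def matrix_matrix_mult_def vec_eq_iff mult.commute)

text \<open>Turns a vanishing sandwich into a violation of \<open>separating\<close>, with rows of
  \<open>P\<close> and \<open>Q\<close> as test vectors.\<close>

lemma sandwich_nth:
  "(Q ** transpose Y ** adj P) $ i $ k = cinner (P $ k) (Y *v (Q $ i))"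
  by (simp add: matrix_matrix_mult_def transpose_def adj_def cinner_def matrix_vector_mult_def
      sum_distrib_right mult_ac)

lemma inverse_of_det_nonzero:
  assumes "det (A :: complex^2^2) \<noteq> 0"
  obtains B where "A ** B = mat 1" "B ** A = mat 1"
  using assms unfolding invertible_det_nz[symmetric] invertible_def by blast

text \<open>Excludes codes of two vectors; \<open>P\<close> and \<open>Q\<close> stand for the
  codewords written as matrices.\<close>

lemma separating_tensor:
  fixes T1 T2 :: "(complex^2^2) set"
  assumes T1: "separating T1" and T2: "separating T2" and P: "P \<noteq> 0" and Q: "Q \<noteq> 0"
  shows "\<exists>X\<in>T1. \<exists>Y\<in>T2. trace (X ** Q ** transpose Y ** adj P) \<noteq> 0"
proof (rule ccontr)
  assume "\<not> ?thesis"
  then have 0: "trace (X ** (Q ** transpose Y ** adj P)) = 0" if "X \<in> T1" "Y \<in> T2" for X Y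
    using that by (simp add: matrix_mul_assoc)
  obtain H where detH: "det H \<noteq> 0"
    and H: "\<And>M. \<forall>X\<in>T1. trace (X ** M) = 0 \<Longrightarrow> \<exists>c. M = mscale c H"
    using separating_annihilator[OF T1] by metis
  then have H': "\<exists>c. Q ** transpose Y ** adj P = mscale c H" if "Y \<in> T2" for Y
    using 0 that by blast
  show False
  proof (cases "det P = 0 \<or> det Q = 0")
    case True
    \<comment> \<open>The sandwich is singular, while \<open>H\<close> is invertible, so the factor
      of \<open>H\<close> is zero.\<close>
    have "Q ** transpose Y ** adj P = 0" if Y: "Y \<in> T2" for Y
    proof -
      obtain c where c: "Q ** transpose Y ** adj P = mscale c H" using H'[OF Y] ..
      have "det (Q ** transpose Y ** adj P) = 0"
        using True by (auto simp: det_mul det_adj_2)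
      then have "c = 0" unfolding c det_mscale_2 using detH by simp
      with c show ?thesis by (simp add: mscale_def vec_eq_iff)
    qed
    then have "cinner (P $ k) (Y *v (Q $ i)) = 0" if "Y \<in> T2" for Y i k
      using that by (simp flip: sandwich_nth)
    moreover obtain i k where "P $ k \<noteq> 0" "Q $ i \<noteq> 0" using P Q by (metis vec_eq_iff zero_index)
    ultimately show False using T2 unfolding separating_def by blast
  next
    case False
    then obtain P' Q' where P': "adj P ** P' = mat 1" and Q': "Q' ** Q = mat 1"
      using inverse_of_det_nonzero[of "adj P"] inverse_of_det_nonzero[of Q] by (metis complex_cnj_zero_iff det_adj_2)
    \<comment> \<open>Solves \<open>Q ** transpose Y ** adj P = mscale c H\<close> for
      \<open>Y\<close> up to the factor \<open>c\<close>.\<close>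
    define K where "K = transpose (Q' ** H ** P')"
    have T2_scaled: "\<exists>c. Y = mscale c K" if Y: "Y \<in> T2" for Y
    proof -
      obtain c where c: "Q ** transpose Y ** adj P = mscale c H" using H'[OF Y] ..
      have "transpose Y = (Q' ** Q) ** transpose Y ** (adj P ** P')" by (simp add: P' Q')
      also have "\<dots> = Q' ** (Q ** transpose Y ** adj P) ** P'" by (simp add: matrix_mul_assoc)
      also have "\<dots> = mscale c (Q' ** H ** P')" by (simp add: c mscale_mult_left mscale_mult_right)
      finally have "Y = transpose (mscale c (Q' ** H ** P'))" by (metis transpose_transpose)
      also have "\<dots> = mscale c K" by (simp add: K_def transpose_def mscale_def vec_eq_iff)
      finally show ?thesis ..
    qed
    \<comment> \<open>All of \<open>T2\<close> consists of multiples of \<open>K\<close>, so no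
      element of it separates \<open>u\<close> from the first basis vector.\<close>
    obtain u where u: "u \<noteq> 0" "cinner u (K *v axis 1 1) = 0" using orthogonal_vector_2 .
    have "axis 1 1 \<noteq> (0 :: complex^2)" by (simp add: axis_eq_0_iff)
    then obtain Y where "Y \<in> T2" "cinner u (Y *v axis 1 1) \<noteq> 0"
      using T2 u(1) unfolding separating_def by blast
    moreover obtain c where "Y = mscale c K" using T2_scaled[OF \<open>Y \<in> T2\<close>] ..
    ultimately show False using u(2) by (simp add: cinner_mscale)
  qed
qed

lemma trace_mult_adj_eq_0: "trace (K ** adj K) = 0 \<longleftrightarrow> K = 0"
proof
  assume "trace (K ** adj K) = 0"
  moreover have "trace (K ** adj K) = of_real (\<Sum>i\<in>UNIV. \<Sum>j\<in>UNIV. (cmod (K $ i $ j))\<^sup>2)"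
    by (simp only: trace_def matrix_matrix_mult_def adj_def complex_norm_square of_real_sum vec_lambda_beta)
  ultimately have "(\<Sum>i\<in>UNIV. \<Sum>j\<in>UNIV. (cmod (K $ i $ j))\<^sup>2) = 0" by (simp only: of_real_eq_0_iff)
  then show "K = 0" by (simp add: sum_nonneg_eq_0_iff sum_nonneg vec_eq_iff)
qed (simp add: trace_def)

text \<open>All products of distinct \<open>P t\<close> and \<open>adj (P s)\<close> are multiples
  of one invertible \<open>H\<close>; the cases differ in whether some \<open>P s\<close> can be
  cancelled.\<close>

lemma separating_no_triple:
  fixes T :: "(complex^2^2) set" and P :: "nat \<Rightarrow> complex^2^2"
  assumes T: "separating T"
    and P: "\<And>s t X. s < 3 \<Longrightarrow> t < 3 \<Longrightarrow> s \<noteq> t \<Longrightarrow> X \<in> T \<Longrightarrow> trace (X ** P t ** adj (P s)) = 0"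
    and orth: "\<And>s t. s < 3 \<Longrightarrow> t < 3 \<Longrightarrow> s \<noteq> t \<Longrightarrow> trace (P t ** adj (P s)) = 0"
  shows "\<exists>s<3. P s = 0"
proof (rule ccontr)
  assume "\<not> ?thesis"
  then have nz: "P s \<noteq> 0" if "s < 3" for s using that by blast
  obtain H where detH: "det H \<noteq> 0"
    and H: "\<And>M. \<forall>X\<in>T. trace (X ** M) = 0 \<Longrightarrow> \<exists>c. M = mscale c H"
    using separating_annihilator[OF T] by metis
  have H': "\<exists>c. P t ** adj (P s) = mscale c H" if "s < 3" "t < 3" "s \<noteq> t" for s t
    using P[OF that] by (intro H) (simp add: matrix_mul_assoc)
  show False
  proof (cases "\<exists>s<3. det (P s) \<noteq> 0")
    case True
    then obtain s where s: "s < 3" "det (P s) \<noteq> 0" by blast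
    obtain t u where tu: "t < 3" "u < 3" "t \<noteq> s" "u \<noteq> s" "t \<noteq> u"
    proof -
      have "s = 0 \<or> s = 1 \<or> s = 2" using s(1) by linarith
      then show ?thesis using that[of 1 2] that[of 0 2] that[of 0 1] by auto
    qed
    obtain B where B: "adj (P s) ** B = mat 1"
      using inverse_of_det_nonzero[of "adj (P s)"] s(2) by (metis complex_cnj_zero_iff det_adj_2)
    \<comment> \<open>Cancelling \<open>adj (P s)\<close> makes the other two matrices parallel,
      which contradicts their orthogonality.\<close>
    have scaled: "\<exists>c. P t = mscale c (H ** B)" if t: "t < 3" "t \<noteq> s" for t
    proof -
      obtain c where c: "P t ** adj (P s) = mscale c H" using H'[of s t] s(1) t by blast
      have "P t = P t ** adj (P s) ** B" by (simp add: B flip: matrix_mul_assoc)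
      then show ?thesis by (auto simp: c mscale_mult_left)
    qed
    obtain c d where c: "P t = mscale c (H ** B)" and d: "P u = mscale d (H ** B)"
      using scaled tu by meson
    have "trace (P t ** adj (P u)) = c * cnj d * trace ((H ** B) ** adj (H ** B))"
      by (simp add: c d adj_mscale mscale_mult_left mscale_mult_right trace_mscale)
    then have "c = 0 \<or> d = 0 \<or> H ** B = 0"
      using orth[of u t] tu by (simp add: trace_mult_adj_eq_0)
    then have "P t = 0 \<or> P u = 0" by (auto simp: c d mscale_def vec_eq_iff)
    then show False using nz tu by blast
  next
    case False
    have "\<exists>u v. P s = outer v u" if "s < 3" for s
      using False that rank_one_of_det_0[of "P s"] by blast
    then obtain u v where uv: "\<And>s. s < 3 \<Longrightarrow> P s = outer (v s) (u s)" by metis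
    have u: "u s \<noteq> 0" and v: "v s \<noteq> 0" if "s < 3" for s
      using nz[OF that] uv[OF that] by (auto simp: outer_def vec_eq_iff)
    \<comment> \<open>The product is singular and a multiple of \<open>H\<close>, hence zero; for
      rank-one factors this leaves the inner product of the row factors.\<close>
    have "cinner (u t) (u s) = 0" if st: "s < 3" "t < 3" "s \<noteq> t" for s t
    proof -
      obtain c where c: "P t ** adj (P s) = mscale c H" using H'[OF st] ..
      have "det (P t ** adj (P s)) = 0" using False st by (simp add: det_mul)
      then have "c = 0" unfolding c det_mscale_2 using detH by simp
      with c have "P t ** adj (P s) = 0" by (simp add: mscale_def vec_eq_iff)
      moreover have "(P t ** adj (P s)) $ i $ j = v t $ i * cnj (v s $ j) * cinner (u t) (u s)" for i j
        using st by (simp add: uv outer_def adj_def matrix_matrix_mult_def cinner_def sum_distrib_left mult_ac)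
      ultimately have "v t $ i * cnj (v s $ j) * cinner (u t) (u s) = 0" for i j by (metis zero_index)
      moreover obtain i j where "v t $ i \<noteq> 0" "v s $ j \<noteq> 0"
        using v[OF st(1)] v[OF st(2)] by (metis vec_eq_iff zero_index)
      ultimately show ?thesis by (metis complex_cnj_zero_iff mult_eq_0_iff)
    qed
    then show False
      using pairwise_orthogonal_2[of "u 0" "u 1" "u 2"] u by simp
  qed
qed

subsection \<open>Codes for pairs of qubit channels\<close>

definition unpack :: "complex^('a \<times> 'b) \<Rightarrow> complex^'b^'a" where
  "unpack \<psi> = (\<chi> i j. \<psi> $ (i, j))"

lemma unpack_eq_0_iff: "unpack \<psi> = 0 \<longleftrightarrow> \<psi> = 0"
  by (simp add: unpack_def vec_eq_iff)

lemma unpack_kron: "unpack (kron A B *v \<psi>) = A ** unpack \<psi> ** transpose B"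
proof -
  have "unpack (kron A B *v \<psi>) $ i $ j = (A ** unpack \<psi> ** transpose B) $ i $ j" for i j
  proof -
    have "unpack (kron A B *v \<psi>) $ i $ j = (\<Sum>a\<in>UNIV. \<Sum>b\<in>UNIV. A $ i $ a * B $ j $ b * \<psi> $ (a, b))"
      unfolding unpack_def matrix_vector_mult_def kron_def UNIV_Times_UNIV[symmetric] sum.cartesian_product'
      by simp
    also have "\<dots> = (\<Sum>b\<in>UNIV. \<Sum>a\<in>UNIV. A $ i $ a * B $ j $ b * \<psi> $ (a, b))"
      by (rule sum.swap)
    finally show ?thesis
      by (simp add: matrix_matrix_mult_def unpack_def transpose_def sum_distrib_left mult_ac)
  qed
  then show ?thesis by (simp add: vec_eq_iff)
qed

lemma cinner_unpack: "cinner x y = trace (unpack y ** adj (unpack x))"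
proof -
  have "cinner x y = (\<Sum>i\<in>UNIV. \<Sum>j\<in>UNIV. cnj (x $ (i, j)) * y $ (i, j))"
    unfolding cinner_def UNIV_Times_UNIV[symmetric] sum.cartesian_product' by simp
  then show ?thesis
    by (simp add: trace_def matrix_matrix_mult_def unpack_def adj_def mult.commute)
qed

lemma adj_transpose: "adj (transpose A) = transpose (adj A)"
  by (simp add: adj_def transpose_def vec_eq_iff)

lemma transpose_mult: "transpose (A ** B) = transpose B ** transpose (A :: complex^'n^'m)"
  by (simp add: transpose_def matrix_matrix_mult_def vec_eq_iff mult.commute)

text \<open>Unpacked, \<open>kron A B\<close> multiplies by \<open>A\<close> on the left and
  \<open>transpose B\<close> on the right; cyclicity of the trace then collects one Kraus pair per
  channel.\<close>

lemma cinner_kron: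
  "cinner (kron A B *v \<psi>) (kron A' B' *v \<phi>) =
   trace ((adj A ** A') ** unpack \<phi> ** transpose (adj B ** B') ** adj (unpack \<psi>))"
proof -
  let ?M = "A' ** unpack \<phi> ** transpose B' ** transpose (adj B) ** adj (unpack \<psi>)"
  have "cinner (kron A B *v \<psi>) (kron A' B' *v \<phi>) = trace (?M ** adj A)"
    by (simp add: cinner_unpack unpack_kron adj_mult adj_transpose matrix_mul_assoc)
  also have "\<dots> = trace (adj A ** ?M)" by (rule trace_mul_sym)
  finally show ?thesis by (simp add: transpose_mult matrix_mul_assoc)
qed

text \<open>Transposition exchanges the roles of the two channels.\<close>

lemma trace_sandwich_swap:
  "trace (X ** Q ** transpose Y ** adj P) =
   trace (Y ** transpose Q ** transpose X ** adj (transpose P))"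
proof -
  have "trace (X ** Q ** transpose Y ** adj P) = trace (transpose (X ** Q ** transpose Y ** adj P))"
    by (simp add: trace_def transpose_def)
  also have "\<dots> = trace (adj (transpose P) ** (Y ** transpose Q ** transpose X))"
    by (simp add: transpose_mult adj_transpose matrix_mul_assoc transpose_transpose)
  also have "\<dots> = trace (Y ** transpose Q ** transpose X ** adj (transpose P))"
    by (rule trace_mul_sym)
  finally show ?thesis .
qed

definition kraus_pairs :: "nat \<Rightarrow> (nat \<Rightarrow> complex^'n^'m) \<Rightarrow> (complex^'n^'n) set" where
  "kraus_pairs r E = {adj (E i) ** E j |i j. i < r \<and> j < r}"

text \<open>Completeness puts the identity into the span of the Kraus pairs.\<close>

lemma trace_zero_of_kraus_pairs:
  assumes "kraus_rep N r E" and "\<And>X. X \<in> kraus_pairs r E \<Longrightarrow> trace (X ** M) = 0"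
  shows "trace M = 0"
proof -
  have "trace M = trace ((\<Sum>i<r. adj (E i) ** E i) ** M)"
    using assms(1) by (simp add: kraus_rep_def)
  also have "\<dots> = (\<Sum>i<r. trace (adj (E i) ** E i ** M))"
    by (simp add: sum_matrix_mult_left trace_sum)
  also have "\<dots> = 0"
    using assms(2) by (intro sum.neutral) (auto simp: kraus_pairs_def)
  finally show ?thesis .
qed

text \<open>Vectors violating \<open>separating\<close> form a code of size 2; the reversed pair is
  handled by conjugation.\<close>

lemma separating_of_no_code:
  assumes "\<nexists>\<psi>. zero_error_code r E 2 \<psi>"
  shows "separating (kraus_pairs r E)"
  unfolding separating_def
proof (intro allI impI, rule ccontr)
  fix u v :: "complex^'a"
  assume nz: "u \<noteq> 0" "v \<noteq> 0" and "\<not> (\<exists>X\<in>kraus_pairs r E. cinner u (X *v v) \<noteq> 0)"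
  then have "cinner u (adj (E i) ** E j *v v) = 0" if "i < r" "j < r" for i j
    using that unfolding kraus_pairs_def by blast
  then have 0: "cinner (E i *v u) (E j *v v) = 0" if "i < r" "j < r" for i j
    using that by (simp only: cinner_adj)
  then have "cinner (E i *v v) (E j *v u) = 0" if "i < r" "j < r" for i j
    using that by (subst cinner_commute) simp
  then have "zero_error_code r E 2 (\<lambda>s. if s = 0 then u else v)"
    using nz 0 by (auto simp: zero_error_code_def less_2_cases_iff)
  with assms show False by blast
qed

text \<open>The identity lies in the graph, so codewords are orthogonal vectors of a plane.\<close>

lemma qubit_no_code_3:
  fixes E :: "nat \<Rightarrow> complex^2^'m"
  assumes "kraus_rep N r E"
  shows "\<nexists>\<psi>. zero_error_code r E 3 \<psi>"
proof
  assume "\<exists>\<psi>. zero_error_code r E 3 \<psi>"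
  then obtain \<psi> where \<psi>: "zero_error_code r E 3 \<psi>" ..
  have orth: "cinner (\<psi> s) (\<psi> t) = 0" if "s < 3" "t < 3" "s \<noteq> t" for s t
  proof -
    have "trace (outer (\<psi> t) (\<psi> s)) = 0"
    proof (rule trace_zero_of_kraus_pairs[OF assms])
      show "trace (X ** outer (\<psi> t) (\<psi> s)) = 0" if "X \<in> kraus_pairs r E" for X
        using that \<psi> \<open>s < 3\<close> \<open>t < 3\<close> \<open>s \<noteq> t\<close>
        by (auto simp: trace_mult_outer kraus_pairs_def zero_error_code_def cinner_adj)
    qed
    then show ?thesis using trace_mult_outer[of "mat 1" "\<psi> t" "\<psi> s"] by simp
  qed
  have "\<psi> s \<noteq> 0" if "s < 3" for s using \<psi> that by (simp add: zero_error_code_def)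
  then show False using pairwise_orthogonal_2[of "\<psi> 0" "\<psi> 1" "\<psi> 2"] orth by simp
qed

lemma tensor_code_trace:
  assumes "zero_error_code (r1 * r2) (\<lambda>k. kron (E (k div r2)) (F (k mod r2))) m \<psi>"
    and "s < m" "t < m" "s \<noteq> t" and "X \<in> kraus_pairs r1 E" "Y \<in> kraus_pairs r2 F"
  shows "trace (X ** unpack (\<psi> t) ** transpose Y ** adj (unpack (\<psi> s))) = 0"
proof -
  obtain i j where X: "X = adj (E i) ** E j" "i < r1" "j < r1"
    using assms(5) by (auto simp: kraus_pairs_def)
  obtain k l where Y: "Y = adj (F k) ** F l" "k < r2" "l < r2"
    using assms(6) by (auto simp: kraus_pairs_def)
  \<comment> \<open>The code of a pair of indices stays in range, so the hypothesis applies to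
    it.\<close>
  have lt: "a * r2 + b < r1 * r2" if "a < r1" "b < r2" for a b
  proof -
    have "a * r2 + b < Suc a * r2" using that by simp
    also have "\<dots> \<le> r1 * r2" using that by (intro mult_right_mono) auto
    finally show ?thesis .
  qed
  have "cinner (kron (E ((i * r2 + k) div r2)) (F ((i * r2 + k) mod r2)) *v \<psi> s)
      (kron (E ((j * r2 + l) div r2)) (F ((j * r2 + l) mod r2)) *v \<psi> t) = 0"
    using assms(1)[unfolded zero_error_code_def, THEN conjunct2, rule_format, OF assms(2-4)
        lt[OF X(2) Y(2)] lt[OF X(3) Y(3)]] .
  then show ?thesis using X Y by (simp add: cinner_kron)
qed

lemma separating_no_tensor_triple:
  fixes E :: "nat \<Rightarrow> complex^2^'m1" and F :: "nat \<Rightarrow> complex^2^'m2"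
  assumes E: "kraus_rep N1 r1 E" and F: "kraus_rep N2 r2 F" and sep: "separating (kraus_pairs r1 E)"
    and P: "\<And>s t X Y. \<lbrakk>s < 3; t < 3; s \<noteq> t; X \<in> kraus_pairs r1 E; Y \<in> kraus_pairs r2 F\<rbrakk> \<Longrightarrow>
      trace (X ** P t ** transpose Y ** adj (P s)) = 0"
  shows "\<exists>s<(3::nat). P s = 0"
proof -
  have 0: "trace (X ** P t ** adj (P s)) = 0"
    if st: "s < 3" "t < 3" "s \<noteq> t" and X: "X \<in> kraus_pairs r1 E" for s t X
  proof -
    \<comment> \<open>The swap puts \<open>Y\<close> in front, where completeness replaces it by the
      identity; a second swap, with \<open>mat 1\<close> for \<open>Y\<close>, undoes the
      transposition.\<close>
    have "trace (transpose (P t) ** transpose X ** adj (transpose (P s))) = 0"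
      using P[OF st X] unfolding trace_sandwich_swap[of X]
      by - (rule trace_zero_of_kraus_pairs[OF F], simp add: matrix_mul_assoc)
    then show ?thesis using trace_sandwich_swap[of X "P t" "mat 1" "P s"] by (simp add: transpose_mat)
  qed
  show ?thesis
  proof (rule separating_no_triple[OF sep 0])
    show "trace (P t ** adj (P s)) = 0" if "s < 3" "t < 3" "s \<noteq> t" for s t
      using 0[OF that] by - (rule trace_zero_of_kraus_pairs[OF E], simp add: matrix_mul_assoc)
  qed
qed

theorem corollary9:
  fixes N1 :: "complex^2^2 \<Rightarrow> complex^('m1::finite)^('m1::finite)"
    and N2 :: "complex^2^2 \<Rightarrow> complex^('m2::finite)^('m2::finite)"
  assumes "quantum_channel N1" and "quantum_channel N2"
  shows "\<not> ((zero_error_capacity1 N1 = 0 \<or> zero_error_capacity1 N2 = 0) \<and>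
            zero_error_capacity1 (tensor_map N1 N2) >
              zero_error_capacity1 N1 + zero_error_capacity1 N2)"
proof -
  obtain r1 E where E: "kraus_rep N1 r1 E" using kraus_rep_exists[OF assms(1)] .
  obtain r2 F where F: "kraus_rep N2 r2 F" using kraus_rep_exists[OF assms(2)] .
  let ?K = "\<lambda>k. kron (E (k div r2)) (F (k mod r2))"
  let ?T = "tensor_map N1 N2"
  note K = kraus_rep_tensor_map[OF E F]
  have no3: "\<nexists>\<psi>. zero_error_code r1 E (Suc 2) \<psi>" "\<nexists>\<psi>. zero_error_code r2 F (Suc 2) \<psi>"
    using qubit_no_code_3[OF E] qubit_no_code_3[OF F] by (simp_all add: eval_nat_numeral)
  note ge1 = channel_alpha_ge_1[OF E no3(1)] channel_alpha_ge_1[OF F no3(2)]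
  note le2 = channel_alpha_bounds(1)[OF E no3(1)] channel_alpha_bounds(1)[OF F no3(2)]
  have sep1: "separating (kraus_pairs r1 E)" if "channel_alpha N1 = 1"
    using channel_alpha_bounds(2)[OF E no3(1), of 2] that by (intro separating_of_no_code) auto
  have sep2: "separating (kraus_pairs r2 F)" if "channel_alpha N2 = 1"
    using channel_alpha_bounds(2)[OF F no3(2), of 2] that by (intro separating_of_no_code) auto
  have code1: "\<nexists>\<psi>. zero_error_code (r1 * r2) ?K (Suc 1) \<psi>"
    if "channel_alpha N1 = 1" "channel_alpha N2 = 1"
  proof
    assume "\<exists>\<psi>. zero_error_code (r1 * r2) ?K (Suc 1) \<psi>"
    then obtain \<psi> where \<psi>: "zero_error_code (r1 * r2) ?K (Suc 1) \<psi>" ..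
    then have "unpack (\<psi> 0) \<noteq> 0" "unpack (\<psi> 1) \<noteq> 0"
      by (simp_all add: zero_error_code_def unpack_eq_0_iff)
    from separating_tensor[OF sep1 sep2 this] that tensor_code_trace[OF \<psi>, of 0 1]
    show False by auto
  qed
  have code2: "\<nexists>\<psi>. zero_error_code (r1 * r2) ?K (Suc 2) \<psi>"
    if "channel_alpha N1 = 1 \<or> channel_alpha N2 = 1"
  proof
    assume "\<exists>\<psi>. zero_error_code (r1 * r2) ?K (Suc 2) \<psi>"
    then obtain \<psi> where "zero_error_code (r1 * r2) ?K (Suc 2) \<psi>" ..
    then have \<psi>: "zero_error_code (r1 * r2) ?K 3 \<psi>" by (simp add: eval_nat_numeral)
    note tr = tensor_code_trace[OF \<psi>]
    have "\<exists>s<3. unpack (\<psi> s) = 0"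
      using that
    proof
      assume "channel_alpha N1 = 1"
      from separating_no_tensor_triple[OF E F sep1[OF this], of "\<lambda>s. unpack (\<psi> s)"] tr
      show ?thesis by blast
    next
      assume "channel_alpha N2 = 1"
      \<comment> \<open>The transposed codewords satisfy the trace condition with the channels
        exchanged.\<close>
      have "trace (Y ** transpose (unpack (\<psi> t)) ** transpose X ** adj (transpose (unpack (\<psi> s)))) = 0"
        if "s < 3" "t < 3" "s \<noteq> t" "Y \<in> kraus_pairs r2 F" "X \<in> kraus_pairs r1 E" for s t X Y
        using tr[OF that(1-3,5,4)] by (simp only: trace_sandwich_swap[of X])
      from separating_no_tensor_triple[OF F E sep2[OF \<open>channel_alpha N2 = 1\<close>],
          of "\<lambda>s. transpose (unpack (\<psi> s))", OF this]
      obtain s where "s < 3" "transpose (unpack (\<psi> s)) = 0" by blast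
      then show ?thesis by (auto simp: transpose_def vec_eq_iff)
    qed
    then show False using \<psi> by (auto simp: zero_error_code_def unpack_eq_0_iff)
  qed
  \<comment> \<open>Both \<alpha> lie between 1 and 2, so with one of them 1 the product is 1 or 2,
    the bounds that \<open>code1\<close> and \<open>code2\<close> provide.\<close>
  have T: "1 \<le> channel_alpha ?T \<and> channel_alpha ?T \<le> channel_alpha N1 * channel_alpha N2"
    if one: "channel_alpha N1 = 1 \<or> channel_alpha N2 = 1"
  proof -
    have "channel_alpha ?T \<le> channel_alpha N1 * channel_alpha N2"
    proof (cases "channel_alpha N1 = 1 \<and> channel_alpha N2 = 1")
      case True
      then show ?thesis using channel_alpha_bounds(1)[OF K code1] by simp
    next
      case False
      then have "channel_alpha N1 * channel_alpha N2 = 2" using one ge1 le2 by auto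
      then show ?thesis using channel_alpha_bounds(1)[OF K code2[OF one]] by simp
    qed
    then show ?thesis using channel_alpha_ge_1[OF K code2[OF one]] by simp
  qed
  \<comment> \<open>The lower bound keeps away from \<open>a = 0\<close>, where the logarithm
    carries no meaning.\<close>
  have eq1: "a = 1" if "log 2 (real a) = 0" "1 \<le> a" for a :: nat
    using that zero_less_log_cancel_iff[of 2 "real a"] by (cases "a = 1") auto
  show ?thesis
  proof
    assume *: "(zero_error_capacity1 N1 = 0 \<or> zero_error_capacity1 N2 = 0) \<and>
      zero_error_capacity1 ?T > zero_error_capacity1 N1 + zero_error_capacity1 N2"
    then have "channel_alpha N1 = 1 \<or> channel_alpha N2 = 1"
      using eq1 ge1 unfolding zero_error_capacity1_def by blast
    from T[OF this] have "log 2 (real (channel_alpha ?T)) \<le> log 2 (real (channel_alpha N1 * channel_alpha N2))"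
      using ge1 by (subst log_le_cancel_iff) (auto simp flip: of_nat_mult)
    also have "\<dots> = log 2 (real (channel_alpha N1)) + log 2 (real (channel_alpha N2))"
      using ge1 by (simp add: log_mult)
    finally show False using * by (simp add: zero_error_capacity1_def)
  qed
qed

end
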